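(* Let $\pi:Y\to X$ be a (Galois) double cover of finite graphs, with $X$ connected, and let $\zeta_X(u),\zeta_Y(u)$ be their Ihara zeta functions. Then, as formal power series, $$\frac{\zeta_Y(u)}{\zeta_X(u)}=\sum_{n=0}^\infty f(n)u^n,\qquad f(n)=\sum_{\operatorname{len}(\alpha)=n}\chi(\alpha),$$ where the inner sum is over all effective $0$-cycles $\alpha$ on $X$ of length $n$, and $\chi$ is the multiplicative function on effective $0$-cycles of $X$ with $\chi(\gamma)=1$ if the prime $\gamma$ is split in $Y$ and $\chi(\gamma)=-1$ if $\gamma$ is inert in $Y$.
   Context: A (bidirected) graph is $(V,\vec E,o,t,\iota)$ with vertices $V$, directed edges $\vec E$, maps $o,t:\vec E\to V$, and an involution $\iota$ of $\vec E$ (fixed points allowed) with $o(\iota(e))=t(e)$, $t(\iota(e))=o(e)$. A path of length $\ell$ is $[e_1\cdots e_\ell]$ with $o(e_{i+1})=t(e_i)$; closed if $o(e_1)=t(e_\ell)$; reduced if $e_{i+1}\ne\iota(e_i)$ for all $i$ and $e_1\ne\iota(e_\ell)$. A prime is an equivalence class, under cyclic rotation, of closed reduced paths that are not repetitions of a shorter path; $\operatorname{len}(\gamma)$ is its length. The Ihara zeta function is $\zeta_X(u)=\prod_{\gamma\text{ prime}}(1-u^{\operatorname{len}(\gamma)})^{-1}$. Effective $0$-cycles on $X$ are elements $\alpha=\sum_\gamma a_\gamma\gamma$ of the free commutative monoid on the primes; $\operatorname{len}(\alpha)=\sum a_\gamma\operatorname{len}(\gamma)$ and $\chi(\alpha)=\prod\chi(\gamma)^{a_\gamma}$.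 A double cover $\pi:Y\to X$ consists of maps on vertices and on directed edges commuting with $o,t,\iota$, surjective on vertices, inducing for each vertex $v$ of $Y$ a bijection from the edges with origin $v$ to the edges with origin $\pi(v)$, and $2$-to-$1$ on vertices and on directed edges. A prime $\gamma$ of $X$ of length $\ell$ is split if its representatives each have two distinct closed reduced lifts of length $\ell$ to $Y$ (so there are two primes of $Y$ over $\gamma$, of length $\ell$), and inert if no lift of length $\ell$ is closed (so there is a single prime of $Y$ over $\gamma$, of length $2\ell$, mapping to $\gamma$ traversed twice). *)

theory Defs
  imports
    "Graph_Theory.Digraph_Component"
    "HOL-Computational_Algebra.Formal_Power_Series"
    "HOL-Library.Multiset"
begin

section \<open>Bidirected graphs, reduced closed paths and primes\<close>

text \<open>
  The maps $o$ and $t$ are \<^const>\<open>tail\<close> and \<^const>\<open>head\<close>. The locale \<open>bidirected_digraph\<close>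
  of the library is not applicable because it excludes fixed points of the involution.
\<close>

locale bidirected_graph = wf_digraph G for G :: "('v, 'e) pre_digraph" +
  fixes \<iota> :: "'e \<Rightarrow> 'e"
  assumes inv_in_arcs: "e \<in> arcs G \<Longrightarrow> \<iota> e \<in> arcs G"
    and inv_inv: "e \<in> arcs G \<Longrightarrow> \<iota> (\<iota> e) = e"
    and tail_inv: "e \<in> arcs G \<Longrightarrow> tail G (\<iota> e) = head G e"
    and head_inv: "e \<in> arcs G \<Longrightarrow> head G (\<iota> e) = tail G e"

text \<open>\<^const>\<open>wf_digraph.closed_w\<close> describes the closed paths of positive length.\<close>

definition closed_reduced :: "('v, 'e) pre_digraph \<Rightarrow> ('e \<Rightarrow> 'e) \<Rightarrow> 'e list \<Rightarrow> bool" where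
  "closed_reduced G \<iota> p \<longleftrightarrow>
     wf_digraph.closed_w G p \<and>
     (\<forall>k. Suc k < length p \<longrightarrow> p ! Suc k \<noteq> \<iota> (p ! k)) \<and>
     hd p \<noteq> \<iota> (last p)"

definition repetition :: "'e list \<Rightarrow> bool" where
  "repetition p \<longleftrightarrow> (\<exists>q m. length q < length p \<and> p = concat (replicate m q))"

definition primes :: "('v, 'e) pre_digraph \<Rightarrow> ('e \<Rightarrow> 'e) \<Rightarrow> 'e list set set" where
  "primes G \<iota> =
     {p. closed_reduced G \<iota> p \<and> \<not> repetition p} // {(p, q). \<exists>n. q = rotate n p}"

text \<open>All representatives of a prime have the same length.\<close>

definition prime_len :: "'e list set \<Rightarrow> nat" where
  "prime_len \<gamma> = the_elem (length ` \<gamma>)"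


section \<open>The Ihara zeta function\<close>

text \<open>
  The product over the (possibly infinite) set of primes is the limit of the finite
  subproducts in the usual topology on formal power series.
\<close>

definition ihara_zeta :: "('v, 'e) pre_digraph \<Rightarrow> ('e \<Rightarrow> 'e) \<Rightarrow> rat fps" where
  "ihara_zeta G \<iota> =
     Lim (finite_subsets_at_top (primes G \<iota>))
       (\<lambda>F. \<Prod>\<gamma>\<in>F. inverse (1 - fps_X ^ prime_len \<gamma>))"


section \<open>Effective 0-cycles\<close>

definition effective_cycles :: "('v, 'e) pre_digraph \<Rightarrow> ('e \<Rightarrow> 'e) \<Rightarrow> 'e list set multiset set" where
  "effective_cycles G \<iota> = {\<alpha>. set_mset \<alpha> \<subseteq> primes G \<iota>}"

definition cycle_len :: "'e list set multiset \<Rightarrow> nat" where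
  "cycle_len \<alpha> = (\<Sum>\<gamma>\<in>#\<alpha>. prime_len \<gamma>)"


section \<open>Double covers\<close>

text \<open>
  \<open>Y\<close> need not be connected. Every such cover is Galois: exchanging the two elements of
  each fibre is an automorphism of \<open>Y\<close> over \<open>X\<close>.
\<close>

locale double_cover =
  Y: bidirected_graph Y \<iota>\<^sub>Y + X: bidirected_graph X \<iota>\<^sub>X
  for Y :: "('w, 'f) pre_digraph" and \<iota>\<^sub>Y and X :: "('v, 'e) pre_digraph" and \<iota>\<^sub>X +
  fixes \<pi>\<^sub>V :: "'w \<Rightarrow> 'v" and \<pi>\<^sub>E :: "'f \<Rightarrow> 'e"
  assumes vertex_surj: "\<pi>\<^sub>V ` verts Y = verts X"
    and edge_map: "e \<in> arcs Y \<Longrightarrow> \<pi>\<^sub>E e \<in> arcs X"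
    and tail_map: "e \<in> arcs Y \<Longrightarrow> tail X (\<pi>\<^sub>E e) = \<pi>\<^sub>V (tail Y e)"
    and head_map: "e \<in> arcs Y \<Longrightarrow> head X (\<pi>\<^sub>E e) = \<pi>\<^sub>V (head Y e)"
    and inv_map: "e \<in> arcs Y \<Longrightarrow> \<pi>\<^sub>E (\<iota>\<^sub>Y e) = \<iota>\<^sub>X (\<pi>\<^sub>E e)"
    and star_bij: "v \<in> verts Y \<Longrightarrow> bij_betw \<pi>\<^sub>E (out_arcs Y v) (out_arcs X (\<pi>\<^sub>V v))"
    and vertex_fibre: "x \<in> verts X \<Longrightarrow> card {v \<in> verts Y. \<pi>\<^sub>V v = x} = 2"
    and edge_fibre: "a \<in> arcs X \<Longrightarrow> card {e \<in> arcs Y. \<pi>\<^sub>E e = a} = 2"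

definition split_prime ::
    "('w, 'f) pre_digraph \<Rightarrow> ('f \<Rightarrow> 'f) \<Rightarrow> ('f \<Rightarrow> 'e) \<Rightarrow> 'e list set \<Rightarrow> bool" where
  "split_prime Y \<iota>\<^sub>Y \<pi>\<^sub>E \<gamma> \<longleftrightarrow>
     (\<forall>p\<in>\<gamma>. card {q. closed_reduced Y \<iota>\<^sub>Y q \<and> map \<pi>\<^sub>E q = p} = 2)"

definition inert_prime :: "('w, 'f) pre_digraph \<Rightarrow> ('f \<Rightarrow> 'e) \<Rightarrow> 'e list set \<Rightarrow> bool" where
  "inert_prime Y \<pi>\<^sub>E \<gamma> \<longleftrightarrow>
     (\<forall>p\<in>\<gamma>. \<not> (\<exists>q. wf_digraph.closed_w Y q \<and> map \<pi>\<^sub>E q = p))"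

text \<open>
  The value 0 is never taken on primes of the base of a double cover, since each of them
  is either split or inert.
\<close>

definition chi_prime ::
    "('w, 'f) pre_digraph \<Rightarrow> ('f \<Rightarrow> 'f) \<Rightarrow> ('f \<Rightarrow> 'e) \<Rightarrow> 'e list set \<Rightarrow> int" where
  "chi_prime Y \<iota>\<^sub>Y \<pi>\<^sub>E \<gamma> =
     (if split_prime Y \<iota>\<^sub>Y \<pi>\<^sub>E \<gamma> then 1 else if inert_prime Y \<pi>\<^sub>E \<gamma> then - 1 else 0)"

definition chi ::
    "('w, 'f) pre_digraph \<Rightarrow> ('f \<Rightarrow> 'f) \<Rightarrow> ('f \<Rightarrow> 'e) \<Rightarrow> 'e list set multiset \<Rightarrow> int" where
  "chi Y \<iota>\<^sub>Y \<pi>\<^sub>E \<alpha> = (\<Prod>\<gamma>\<in>#\<alpha>. chi_prime Y \<iota>\<^sub>Y \<pi>\<^sub>E \<gamma>)"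

end

theory Submission
  imports Defs
begin

text \<open>
  A prime is a shift class of reduced walks \<open>f : nat \<rightarrow> arcs\<close> that are periodic, and its length is
  the least period of \<open>f\<close>. Let \<open>g\<close> be a lift of \<open>f\<close> to \<open>Y\<close>; the only other one is its image under
  the deck involution. Shifting \<open>g\<close> by the least period \<open>l\<close> of \<open>f\<close> gives a lift of \<open>f\<close> again.
  If this is \<open>g\<close>, the prime is split and the two lifts define two primes of length \<open>l\<close>;
  otherwise it is inert and the two lifts define one prime of length \<open>2 l\<close>. In both cases the Euler
  factors of \<open>Y\<close> over the prime multiply to \<open>(1 - u^l)^-1 (1 - \<chi> u^l)^-1\<close>. Only finitely many
  primes affect a given coefficient, so the identity follows from finite products.
\<close>

unbundle fps_syntax

section \<open>Generating functions of weighted multisets\<close>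

definition multisets_of_weight :: "'a set \<Rightarrow> ('a \<Rightarrow> nat) \<Rightarrow> nat \<Rightarrow> 'a multiset set" where
  "multisets_of_weight A w n = {\<alpha>. set_mset \<alpha> \<subseteq> A \<and> (\<Sum>a\<in>#\<alpha>. w a) = n}"

text \<open>The expanded Euler product with factors (1 - c(a) u^(w a))^-1. With c = 1 on the primes
  of a graph it is the Ihara zeta function; with c the splitting character on the primes of X it is
  the series claimed for the quotient.\<close>

definition multiset_gf :: "'a set \<Rightarrow> ('a \<Rightarrow> nat) \<Rightarrow> ('a \<Rightarrow> 'b::field) \<Rightarrow> 'b fps" where
  "multiset_gf A w c = Abs_fps (\<lambda>n. \<Sum>\<alpha>\<in>multisets_of_weight A w n. \<Prod>a\<in>#\<alpha>. c a)"

lemma weight_le_sum_mset: "a \<in># \<alpha> \<Longrightarrow> w a \<le> (\<Sum>a\<in>#\<alpha>. w a :: nat)"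
  by (metis image_mset_add_mset insert_DiffM le_add1 sum_mset.add_mset)

lemma size_le_weight:
  assumes "\<And>a. a \<in># \<alpha> \<Longrightarrow> w a > 0"
  shows "size \<alpha> \<le> (\<Sum>a\<in>#\<alpha>. w a :: nat)"
  using assms
proof (induction \<alpha>)
  case (add a \<alpha>)
  then have "size \<alpha> \<le> (\<Sum>a\<in>#\<alpha>. w a)" "w a > 0" by auto
  then show ?case by simp
qed simp

text \<open>Positive weights bound the size of a multiset by its weight, and a finite set carries
  finitely many multisets of each size.\<close>

lemma finite_multisets_of_weight:
  assumes "finite A" "\<And>a. a \<in> A \<Longrightarrow> w a > 0"
  shows "finite (multisets_of_weight A w n)"
proof (rule finite_subset)
  show "multisets_of_weight A w n \<subseteq> (\<Union>k\<le>n. multisets_of_size A k)"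
    using assms(2) by (force simp: multisets_of_weight_def multisets_of_size_def intro!: size_le_weight)
qed (use assms(1) in auto)

text \<open>If a occurs, one copy of it is removed. What remains ranges over
  \<open>insert a A\<close> again, because further copies may be left; this is the recursion of a
  geometric series.\<close>

lemma multisets_of_weight_insert:
  assumes "a \<notin> A"
  shows "multisets_of_weight (insert a A) w n =
    multisets_of_weight A w n \<union>
      (if w a \<le> n then add_mset a ` multisets_of_weight (insert a A) w (n - w a) else {})"
    (is "?L = ?R")
proof
  show "?L \<subseteq> ?R"
  proof
    fix \<alpha> assume \<alpha>: "\<alpha> \<in> ?L"
    show "\<alpha> \<in> ?R"
    proof (cases "a \<in># \<alpha>")
      case True
      then obtain \<beta> where "\<alpha> = add_mset a \<beta>" by (metis insert_DiffM)
      with \<alpha> show ?thesis by (auto simp: multisets_of_weight_def)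
    next
      case False
      with \<alpha> show ?thesis by (auto simp: multisets_of_weight_def)
    qed
  qed
  show "?R \<subseteq> ?L" by (auto simp: multisets_of_weight_def)
qed

text \<open>Removing one copy of a lowers the weight by \<open>w a\<close> and takes out a factor
  \<open>c a\<close>, so comparing coefficients gives F = G + c(a) u^(w a) F, here with the
  denominator cleared.\<close>

lemma multiset_gf_insert:
  assumes "finite A" "a \<notin> A" "\<And>b. b \<in> insert a A \<Longrightarrow> w b > 0"
  shows "(1 - fps_const (c a) * fps_X ^ w a) * multiset_gf (insert a A) w c = multiset_gf A w c"
proof (rule fps_ext)
  fix n
  let ?M = "multisets_of_weight"
  have fin: "finite (?M A w m)" "finite (?M (insert a A) w m)" for m
    using assms by (auto intro!: finite_multisets_of_weight)
  have disj: "?M A w n \<inter> add_mset a ` ?M (insert a A) w m = {}" for m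
    using assms(2) by (auto simp: multisets_of_weight_def)
  have "multiset_gf (insert a A) w c $ n =
      multiset_gf A w c $ n + (if w a \<le> n then c a * multiset_gf (insert a A) w c $ (n - w a) else 0)"
  proof (cases "w a \<le> n")
    case True
    have "(\<Sum>\<alpha>\<in>add_mset a ` ?M (insert a A) w (n - w a). \<Prod>b\<in>#\<alpha>. c b) =
        (\<Sum>\<alpha>\<in>?M (insert a A) w (n - w a). c a * (\<Prod>b\<in>#\<alpha>. c b))"
      by (subst sum.reindex) (auto simp: inj_on_def)
    with True show ?thesis
      unfolding multiset_gf_def fps_nth_Abs_fps
      by (subst multisets_of_weight_insert[OF assms(2)])
        (simp add: sum.union_disjoint[OF fin(1) finite_imageI[OF fin(2)] disj] sum_distrib_left)
  next
    case False
    then show ?thesis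
      unfolding multiset_gf_def fps_nth_Abs_fps
      by (subst multisets_of_weight_insert[OF assms(2)]) simp
  qed
  then show "((1 - fps_const (c a) * fps_X ^ w a) * multiset_gf (insert a A) w c) $ n =
      multiset_gf A w c $ n"
    by (auto simp: ring_distribs mult.assoc fps_X_power_mult_nth)
qed

lemma prod_inverse_eq_multiset_gf:
  assumes "finite A" "\<And>a. a \<in> A \<Longrightarrow> w a > 0"
  shows "(\<Prod>a\<in>A. inverse (1 - fps_const (c a) * fps_X ^ w a)) = multiset_gf A w c"
  using assms
proof (induction A)
  case empty
  have "multisets_of_weight {} w n = (if n = 0 then {{#}} else {})" for n
    by (auto simp: multisets_of_weight_def)
  then show ?case by (intro fps_ext) (simp add: multiset_gf_def)
next
  case (insert a A)
  let ?d = "1 - fps_const (c a) * fps_X ^ w a"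
  have "w a > 0" using insert.prems by simp
  then have "?d $ 0 \<noteq> 0" by simp
  then have "inverse ?d * ?d = 1" by (rule inverse_mult_eq_1)
  then have "inverse ?d * (?d * multiset_gf (insert a A) w c) = multiset_gf (insert a A) w c"
    by (simp flip: mult.assoc)
  moreover have "?d * multiset_gf (insert a A) w c = multiset_gf A w c"
    using insert by (intro multiset_gf_insert) auto
  ultimately show ?case using insert by simp
qed

lemma multiset_gf_nth_0:
  assumes "\<And>a. a \<in> S \<Longrightarrow> w a > 0"
  shows "multiset_gf S w c $ 0 = 1"
proof -
  have "\<alpha> = {#}" if \<alpha>: "set_mset \<alpha> \<subseteq> S" "(\<Sum>a\<in>#\<alpha>. w a) = 0" for \<alpha>
  proof -
    have "size \<alpha> \<le> (\<Sum>a\<in>#\<alpha>. w a)"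
    proof (rule size_le_weight)
      fix a assume "a \<in># \<alpha>"
      with \<alpha>(1) show "w a > 0" by (intro assms) blast
    qed
    then have "size \<alpha> \<le> 0" unfolding \<alpha>(2) .
    then show ?thesis by simp
  qed
  then have "multisets_of_weight S w 0 = {{#}}"
    unfolding multisets_of_weight_def by auto
  then show ?thesis by (simp add: multiset_gf_def)
qed

text \<open>An element heavier than N cannot occur in a multiset of weight at most N. This reduces
  every coefficient over an infinite set of primes to one over a finite set.\<close>

lemma multiset_gf_nth_truncate:
  assumes "T \<subseteq> S" "{a \<in> S. w a \<le> N} \<subseteq> T" "n \<le> N"
  shows "multiset_gf S w c $ n = multiset_gf T w c $ n"
proof -
  have "multisets_of_weight S w n = multisets_of_weight T w n"
  proof (intro equalityI subsetI)
    fix \<alpha> assume \<alpha>: "\<alpha> \<in> multisets_of_weight S w n"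
    have "a \<in> T" if "a \<in># \<alpha>" for a
      using that \<alpha> assms weight_le_sum_mset[OF that, of w] by (auto simp: multisets_of_weight_def)
    with \<alpha> show "\<alpha> \<in> multisets_of_weight T w n" by (auto simp: multisets_of_weight_def)
  qed (use assms(1) in \<open>auto simp: multisets_of_weight_def\<close>)
  then show ?thesis by (simp add: multiset_gf_def)
qed

text \<open>Convergence of formal power series is eventual constancy of each coefficient:
  coefficient n no longer changes once F contains all elements of weight at most n.\<close>

lemma tendsto_multiset_gf:
  assumes "\<And>a. a \<in> S \<Longrightarrow> w a > 0" and "\<And>n. finite {a \<in> S. w a = n}"
  shows "((\<lambda>F. \<Prod>a\<in>F. inverse (1 - fps_const (c a) * fps_X ^ w a)) \<longlongrightarrow> multiset_gf S w c)
    (finite_subsets_at_top S)"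
proof (rule tendsto_fpsI)
  fix n
  have "{a \<in> S. w a \<le> n} = (\<Union>k\<le>n. {a \<in> S. w a = k})" by auto
  then have fin: "finite {a \<in> S. w a \<le> n}" using assms(2) by simp
  show "\<forall>\<^sub>F F in finite_subsets_at_top S.
      (\<Prod>a\<in>F. inverse (1 - fps_const (c a) * fps_X ^ w a)) $ n = multiset_gf S w c $ n"
    unfolding eventually_finite_subsets_at_top
  proof (intro exI[of _ "{a \<in> S. w a \<le> n}"] conjI fin allI impI)
    fix F assume F: "finite F \<and> {a \<in> S. w a \<le> n} \<subseteq> F \<and> F \<subseteq> S"
    then show "(\<Prod>a\<in>F. inverse (1 - fps_const (c a) * fps_X ^ w a)) $ n = multiset_gf S w c $ n"
      using assms(1) multiset_gf_nth_truncate[of F S w n n c]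
      by (subst prod_inverse_eq_multiset_gf) auto
  qed auto
qed

section \<open>Periodic sequences\<close>

definition periodic :: "nat \<Rightarrow> (nat \<Rightarrow> 'a) \<Rightarrow> bool" where
  "periodic n f \<longleftrightarrow> (\<forall>i. f (i + n) = f i)"

definition has_period :: "(nat \<Rightarrow> 'a) \<Rightarrow> bool" where
  "has_period f \<longleftrightarrow> (\<exists>n>0. periodic n f)"

definition min_period :: "(nat \<Rightarrow> 'a) \<Rightarrow> nat" where
  "min_period f = (LEAST n. n > 0 \<and> periodic n f)"

definition shift :: "nat \<Rightarrow> (nat \<Rightarrow> 'a) \<Rightarrow> nat \<Rightarrow> 'a" where
  "shift n f i = f (i + n)"

lemma periodic_iff_shift: "periodic n f \<longleftrightarrow> shift n f = f"
  by (auto simp: periodic_def shift_def fun_eq_iff)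

lemma shift_shift: "shift m (shift n f) = shift (m + n) f"
  by (simp add: shift_def fun_eq_iff add.assoc)

lemma comp_shift: "h \<circ> shift n f = shift n (h \<circ> f)"
  by (simp add: shift_def fun_eq_iff)

lemma periodic_mult: "periodic n f \<Longrightarrow> periodic (n * k) f"
proof (induction k)
  case (Suc k)
  then show ?case unfolding periodic_def mult_Suc_right by (metis add.assoc)
qed (simp add: periodic_def)

lemma periodic_mod: "periodic n f \<Longrightarrow> f (i mod n) = f i"
  using periodic_mult[of n f "i div n"] unfolding periodic_def by (metis mod_mult_div_eq)

lemma
  assumes "has_period f"
  shows min_period_pos: "min_period f > 0"
    and periodic_min_period: "periodic (min_period f) f"
  using assms LeastI_ex[of "\<lambda>n. n > 0 \<and> periodic n f"]
  unfolding has_period_def min_period_def by auto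

lemma min_period_le: "n > 0 \<Longrightarrow> periodic n f \<Longrightarrow> min_period f \<le> n"
  unfolding min_period_def by (simp add: Least_le)

text \<open>The remainder of a period modulo the least period is again a period. Being smaller than
  the least one, it must be 0.\<close>

lemma periodic_iff_dvd:
  assumes "has_period f"
  shows "periodic n f \<longleftrightarrow> min_period f dvd n"
proof
  assume n: "periodic n f"
  let ?l = "min_period f"
  have "periodic (n mod ?l) f"
    unfolding periodic_def
  proof
    fix i
    have "f (i + n mod ?l) = f (i + n mod ?l + ?l * (n div ?l))"
      using periodic_mult[OF periodic_min_period[OF assms], of "n div ?l"]
      by (simp only: periodic_def)
    also have "i + n mod ?l + ?l * (n div ?l) = i + n" by simp
    also have "f (i + n) = f i" using n by (simp add: periodic_def)
    finally show "f (i + n mod ?l) = f i" .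
  qed
  moreover have "n mod ?l < ?l" using min_period_pos[OF assms] by simp
  ultimately have "n mod ?l = 0" using min_period_le[of "n mod ?l" f] by force
  then show "?l dvd n" by auto
next
  assume "min_period f dvd n"
  then show "periodic n f" using periodic_mult[OF periodic_min_period[OF assms]] by auto
qed

lemma has_period_comp: "has_period f \<Longrightarrow> has_period (h \<circ> f)"
  by (auto simp: has_period_def periodic_def)

text \<open>Sequences are indexed by natural numbers, so a shift can only be undone by shifting on
  to a multiple of the period. The multiple \<open>n * min_period f\<close> is at least n, so the
  truncated subtraction is exact.\<close>

lemma shift_cancel:
  assumes "has_period f"
  shows "shift (m + n * min_period f - n) (shift n f) = shift m f"
proof -
  have "n \<le> n * min_period f" using min_period_pos[OF assms] by simp
  moreover have "periodic (n * min_period f) f" using assms by (simp add: periodic_iff_dvd)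
  ultimately show ?thesis
    unfolding shift_shift periodic_def shift_def fun_eq_iff by (metis add.assoc le_add_diff_inverse2 le_add2 order_trans)
qed

lemma periodic_shift_iff:
  assumes "has_period f"
  shows "periodic k (shift n f) \<longleftrightarrow> periodic k f"
proof
  assume "periodic k (shift n f)"
  then have "periodic k (shift m (shift n f))" for m
    unfolding periodic_def shift_def by (metis add.assoc add.commute)
  from this[of "0 + n * min_period f - n"]
  have "periodic k (shift 0 f)" by (simp only: shift_cancel[OF assms])
  then show "periodic k f" by (simp add: periodic_def shift_def)
next
  assume "periodic k f"
  then show "periodic k (shift n f)"
    unfolding periodic_def shift_def by (metis add.assoc add.commute)
qed

lemma
  assumes "has_period f"
  shows has_period_shift: "has_period (shift n f)"
    and min_period_shift: "min_period (shift n f) = min_period f"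
  using assms by (simp_all add: has_period_def min_period_def periodic_shift_iff)

section \<open>Words and rotation classes as periodic sequences\<close>

definition cyclic_seq :: "'a list \<Rightarrow> nat \<Rightarrow> 'a" where
  "cyclic_seq p i = p ! (i mod length p)"

text \<open>Together with \<open>cyclic_seq\<close> this gives mutually inverse bijections between
  the nonempty words that are not repetitions and the sequences that have a period.\<close>

definition period_word :: "(nat \<Rightarrow> 'a) \<Rightarrow> 'a list" where
  "period_word f = map f [0..<min_period f]"

lemma has_period_cyclic_seq: "p \<noteq> [] \<Longrightarrow> has_period (cyclic_seq p)"
  by (auto simp: has_period_def periodic_def cyclic_seq_def intro!: exI[of _ "length p"])

lemma map_cyclic_seq: "map (cyclic_seq p) [0..<length p] = p"
  by (rule nth_equalityI) (simp_all add: cyclic_seq_def)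

lemma cyclic_seq_map: "p \<noteq> [] \<Longrightarrow> cyclic_seq (map h p) = h \<circ> cyclic_seq p"
  by (auto simp: cyclic_seq_def)

lemma length_period_word [simp]: "length (period_word f) = min_period f"
  by (simp add: period_word_def)

lemma cyclic_seq_map_upt: "n > 0 \<Longrightarrow> periodic n f \<Longrightarrow> cyclic_seq (map f [0..<n]) = f"
  by (auto simp: cyclic_seq_def periodic_mod)

lemma cyclic_seq_period_word: "has_period f \<Longrightarrow> cyclic_seq (period_word f) = f"
  by (simp add: period_word_def cyclic_seq_map_upt min_period_pos periodic_min_period)

lemma period_word_not_Nil: "has_period f \<Longrightarrow> period_word f \<noteq> []"
  using min_period_pos[of f] length_period_word[of f] by force

lemma nth_concat_replicate:
  "i < m * length q \<Longrightarrow> concat (replicate m q) ! i = q ! (i mod length q)"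
proof (induction m arbitrary: i)
  case (Suc m)
  show ?case
  proof (cases "i < length q")
    case False
    with Suc show ?thesis by (simp add: nth_append le_mod_geq)
  qed (simp add: nth_append)
qed simp

lemma length_concat_replicate: "length (concat (replicate m q)) = m * length q"
  by (induction m) auto

text \<open>If p is a repetition of q, then \<open>length q\<close> is a period. Conversely, p is a
  power of the period word of its cyclic sequence.\<close>

lemma repetition_iff_periodic:
  assumes "p \<noteq> []"
  shows "repetition p \<longleftrightarrow> (\<exists>d. 0 < d \<and> d < length p \<and> periodic d (cyclic_seq p))"
proof
  assume "repetition p"
  then obtain q m where q: "length q < length p" "p = concat (replicate m q)"
    by (auto simp: repetition_def)
  have len: "length p = m * length q" using q(2) length_concat_replicate by blast
  have pos: "m * length q > 0" using assms len by (metis length_greater_0_conv)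
  then have "length q > 0" by simp
  have "cyclic_seq p i = q ! (i mod length q)" for i
    unfolding cyclic_seq_def len
    by (subst q(2), subst nth_concat_replicate) (use pos in \<open>simp_all only: mod_less_divisor mod_mod_cancel dvd_triv_right\<close>)
  then have "periodic (length q) (cyclic_seq p)" by (simp add: periodic_def)
  then show "\<exists>d. 0 < d \<and> d < length p \<and> periodic d (cyclic_seq p)" 
    using q(1) \<open>length q > 0\<close> by blast
next
  assume "\<exists>d. 0 < d \<and> d < length p \<and> periodic d (cyclic_seq p)"
  then obtain d where d: "0 < d" "d < length p" "periodic d (cyclic_seq p)" by blast
  let ?f = "cyclic_seq p" and ?l = "min_period (cyclic_seq p)"
  have per: "has_period ?f" using assms by (rule has_period_cyclic_seq)
  \<comment> \<open>The given d need not divide \<open>length p\<close>. The least period does,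
    because \<open>length p\<close> is a period as well; the quotient m is the number of
    repetitions.\<close>
  have "periodic (length p) ?f" by (simp add: periodic_def cyclic_seq_def)
  then obtain m where m: "length p = ?l * m" using periodic_iff_dvd[OF per] by auto
  have "p = concat (replicate m (period_word ?f))"
  proof (rule nth_equalityI)
    fix i assume i: "i < length p"
    then have "p ! i = ?f (i mod ?l)"
      using periodic_mod[OF periodic_min_period[OF per]] by (simp add: cyclic_seq_def)
    also have "\<dots> = period_word ?f ! (i mod ?l)"
      using min_period_pos[OF per] by (simp add: period_word_def)
    finally show "p ! i = concat (replicate m (period_word ?f)) ! i"
      using i m by (simp add: nth_concat_replicate mult.commute)
  qed (simp only: m length_concat_replicate length_period_word mult.commute)
  moreover have "?l < length p" using d(2) min_period_le[OF d(1,3)] by linarith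
  ultimately show "repetition p" unfolding repetition_def by (metis length_period_word)
qed

lemma min_period_cyclic_seq:
  assumes "p \<noteq> []" "\<not> repetition p"
  shows "min_period (cyclic_seq p) = length p"
proof (rule antisym)
  show "min_period (cyclic_seq p) \<le> length p"
    using assms(1) by (intro min_period_le) (auto simp: periodic_def cyclic_seq_def)
  show "length p \<le> min_period (cyclic_seq p)"
    using assms min_period_pos periodic_min_period has_period_cyclic_seq[OF assms(1)]
    unfolding repetition_iff_periodic[OF assms(1)] by (metis linorder_not_less)
qed

lemma period_word_cyclic_seq: "p \<noteq> [] \<Longrightarrow> \<not> repetition p \<Longrightarrow> period_word (cyclic_seq p) = p"
  by (simp add: period_word_def min_period_cyclic_seq map_cyclic_seq)

lemma not_repetition_period_word: "has_period f \<Longrightarrow> \<not> repetition (period_word f)"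
  unfolding repetition_iff_periodic[OF period_word_not_Nil] cyclic_seq_period_word length_period_word
  using min_period_le linorder_not_less by blast

text \<open>Turns the rotation relation that defines primes into shifts of sequences.\<close>

lemma rotate_period_word:
  assumes "has_period f"
  shows "rotate n (period_word f) = period_word (shift n f)"
proof (rule nth_equalityI)
  fix i assume "i < length (rotate n (period_word f))"
  then have i: "i < min_period f" by simp
  then have "rotate n (period_word f) ! i = f ((n + i) mod min_period f)"
    by (subst nth_rotate) (simp_all add: period_word_def)
  also have "\<dots> = shift n f i"
    using periodic_mod[OF periodic_min_period[OF assms]] by (simp add: shift_def add.commute)
  finally show "rotate n (period_word f) ! i = period_word (shift n f) ! i"
    using i assms by (simp add: period_word_def min_period_shift)
qed (simp add: min_period_shift assms)

text \<open>The rotation class of \<open>period_word f\<close>. Applied to the closed geodesics of a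
  graph it yields exactly its primes.\<close>

definition cyclic_class :: "(nat \<Rightarrow> 'a) \<Rightarrow> 'a list set" where
  "cyclic_class f = range (\<lambda>n. period_word (shift n f))"

lemma cyclic_class_shift:
  assumes "has_period f"
  shows "cyclic_class (shift n f) = cyclic_class f"
proof
  show "cyclic_class (shift n f) \<subseteq> cyclic_class f"
    by (auto simp: cyclic_class_def shift_shift)
  show "cyclic_class f \<subseteq> cyclic_class (shift n f)"
    unfolding cyclic_class_def by (metis (no_types, lifting) image_subsetI rangeI shift_cancel[OF assms])
qed

lemma period_word_in_cyclic_class: "period_word f \<in> cyclic_class f"
  unfolding cyclic_class_def by (rule range_eqI[of _ _ 0]) (simp add: shift_def[abs_def])

text \<open>A periodic sequence is recovered from its period word by \<open>cyclic_seq\<close>, so a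
  common representative forces the sequences to agree up to a shift.\<close>

lemma cyclic_class_eq_iff:
  assumes "has_period f" "has_period g"
  shows "cyclic_class f = cyclic_class g \<longleftrightarrow> (\<exists>n. g = shift n f)"
proof
  assume "cyclic_class f = cyclic_class g"
  then have "period_word g \<in> cyclic_class f" using period_word_in_cyclic_class[of g] by simp
  then obtain n where "period_word g = period_word (shift n f)" by (auto simp: cyclic_class_def)
  then have "g = shift n f"
    using assms by (metis cyclic_seq_period_word has_period_shift)
  then show "\<exists>n. g = shift n f" ..
qed (use assms(1) cyclic_class_shift in auto)

lemma prime_len_cyclic_class:
  assumes "has_period f"
  shows "prime_len (cyclic_class f) = min_period f"
proof -
  have "length ` cyclic_class f = {min_period f}"
    by (auto simp: cyclic_class_def min_period_shift[OF assms] image_image)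
  then show ?thesis by (simp add: prime_len_def)
qed

section \<open>Primes as shift classes of periodic reduced walks\<close>

definition walk_seq :: "('v, 'e) pre_digraph \<Rightarrow> (nat \<Rightarrow> 'e) \<Rightarrow> bool" where
  "walk_seq G f \<longleftrightarrow> (\<forall>i. f i \<in> arcs G \<and> head G (f i) = tail G (f (Suc i)))"

definition reduced_seq :: "('v, 'e) pre_digraph \<Rightarrow> ('e \<Rightarrow> 'e) \<Rightarrow> (nat \<Rightarrow> 'e) \<Rightarrow> bool" where
  "reduced_seq G \<iota> f \<longleftrightarrow> walk_seq G f \<and> (\<forall>i. f (Suc i) \<noteq> \<iota> (f i))"

definition closed_geodesics :: "('v, 'e) pre_digraph \<Rightarrow> ('e \<Rightarrow> 'e) \<Rightarrow> (nat \<Rightarrow> 'e) set" where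
  "closed_geodesics G \<iota> = {f. reduced_seq G \<iota> f \<and> has_period f}"

text \<open>The pair of last and first letter is the step where the index wraps around. A general P
  serves both for incidence of consecutive arcs and for absence of backtracking.\<close>

lemma cyclic_seq_all_pairs:
  assumes "p \<noteq> []"
  shows "(\<forall>i. P (cyclic_seq p i) (cyclic_seq p (Suc i))) \<longleftrightarrow>
    (\<forall>k. Suc k < length p \<longrightarrow> P (p ! k) (p ! Suc k)) \<and> P (last p) (hd p)" (is "?L \<longleftrightarrow> ?R")
proof
  assume L: ?L
  have "P (p ! k) (p ! Suc k)" if "Suc k < length p" for k
    using L[rule_format, of k] that by (simp add: cyclic_seq_def)
  moreover have "P (last p) (hd p)"
    using L[rule_format, of "length p - 1"] assms
    by (simp add: cyclic_seq_def last_conv_nth hd_conv_nth)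
  ultimately show ?R by blast
next
  assume R: ?R
  show ?L
  proof
    fix i
    let ?k = "i mod length p"
    have k: "?k < length p" using assms by simp
    show "P (cyclic_seq p i) (cyclic_seq p (Suc i))"
    proof (cases "Suc ?k = length p")
      case True
      then have "?k = length p - 1" by simp
      with True R assms show ?thesis
        by (simp add: cyclic_seq_def mod_Suc last_conv_nth hd_conv_nth)
    next
      case False
      with R k show ?thesis by (simp add: cyclic_seq_def mod_Suc)
    qed
  qed
qed

lemma range_cyclic_seq:
  assumes "p \<noteq> []"
  shows "range (cyclic_seq p) = set p"
proof
  show "range (cyclic_seq p) \<subseteq> set p" using assms by (auto simp: cyclic_seq_def)
  have "set p = cyclic_seq p ` {0..<length p}"
    using set_map[of "cyclic_seq p" "[0..<length p]"] by (simp add: map_cyclic_seq)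
  then show "set p \<subseteq> range (cyclic_seq p)" by blast
qed

context wf_digraph
begin

unbundle fps_syntax

text \<open>Unrolls the recursive walk predicate into a condition on positions, the form to which
  \<open>cyclic_seq_all_pairs\<close> applies.\<close>

lemma cas_iff_nth:
  "p \<noteq> [] \<Longrightarrow> cas u p v \<longleftrightarrow> u = tail G (hd p) \<and> v = head G (last p) \<and>
    (\<forall>k. Suc k < length p \<longrightarrow> head G (p ! k) = tail G (p ! Suc k))"
proof (induction p arbitrary: u)
  case (Cons e p)
  show ?case
  proof (cases p)
    case (Cons e' p')
    have "(\<forall>k. Suc k < length (e # p) \<longrightarrow> head G ((e # p) ! k) = tail G ((e # p) ! Suc k)) \<longleftrightarrow>
        head G e = tail G (hd p) \<and>
        (\<forall>k. Suc k < length p \<longrightarrow> head G (p ! k) = tail G (p ! Suc k))"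
      (is "(\<forall>k. ?P k) \<longleftrightarrow> _")
    proof -
      have "(\<forall>k. ?P k) \<longleftrightarrow> ?P 0 \<and> (\<forall>k. ?P (Suc k))" by (metis not0_implies_Suc)
      then show ?thesis using Cons by simp
    qed
    then show ?thesis using Cons.IH[of "head G e"] Cons by auto
  qed auto
qed simp

lemma closed_w_iff: "closed_w p \<longleftrightarrow> p \<noteq> [] \<and> walk_seq G (cyclic_seq p)"
proof (cases "p = []")
  case False
  have "closed_w p \<longleftrightarrow> set p \<subseteq> arcs G \<and> (\<exists>u. cas u p u)"
    using tail_in_verts[OF subsetD[OF _ hd_in_set[OF False]]] False
    by (auto simp: closed_w_def awalk_def cas_simp[OF False])
  also have "\<dots> \<longleftrightarrow> set p \<subseteq> arcs G \<and>
      (\<forall>k. Suc k < length p \<longrightarrow> head G (p ! k) = tail G (p ! Suc k)) \<and>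
      head G (last p) = tail G (hd p)"
    by (auto simp: cas_iff_nth[OF False])
  also have "\<dots> \<longleftrightarrow> walk_seq G (cyclic_seq p)"
    unfolding walk_seq_def all_conj_distrib range_cyclic_seq[OF False, symmetric] image_subset_iff
      cyclic_seq_all_pairs[OF False, of "\<lambda>a b. head G a = tail G b"] by simp
  finally show ?thesis using False by simp
qed (simp add: closed_w_def)

lemma closed_reduced_iff: "closed_reduced G \<iota> p \<longleftrightarrow> p \<noteq> [] \<and> reduced_seq G \<iota> (cyclic_seq p)"
  using cyclic_seq_all_pairs[of p "\<lambda>a b. b \<noteq> \<iota> a"]
  by (auto simp: closed_reduced_def closed_w_iff reduced_seq_def)

text \<open>The admissible representatives are exactly the period words of closed geodesics, and on
  these words rotation is shifting.\<close>

lemma primes_eq: "primes G \<iota> = cyclic_class ` closed_geodesics G \<iota>"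
proof -
  have cls: "{(p, q). \<exists>n. q = rotate n p} `` {period_word f} = cyclic_class f"
    if "has_period f" for f :: "nat \<Rightarrow> 'b"
    by (auto simp: cyclic_class_def rotate_period_word that)
  have words: "{p. closed_reduced G \<iota> p \<and> \<not> repetition p} = period_word ` closed_geodesics G \<iota>"
  proof (intro equalityI subsetI)
    fix p assume "p \<in> {p. closed_reduced G \<iota> p \<and> \<not> repetition p}"
    then have "p = period_word (cyclic_seq p)" "cyclic_seq p \<in> closed_geodesics G \<iota>"
      by (auto simp: closed_reduced_iff period_word_cyclic_seq closed_geodesics_def
          has_period_cyclic_seq)
    then show "p \<in> period_word ` closed_geodesics G \<iota>" by blast
  next
    fix p assume "p \<in> period_word ` closed_geodesics G \<iota>"
    then show "p \<in> {p. closed_reduced G \<iota> p \<and> \<not> repetition p}"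
      by (auto simp: closed_geodesics_def closed_reduced_iff cyclic_seq_period_word
          period_word_not_Nil not_repetition_period_word)
  qed
  have "primes G \<iota> = (\<lambda>p. {(p, q). \<exists>n. q = rotate n p} `` {p}) ` period_word ` closed_geodesics G \<iota>"
    unfolding primes_def quotient_def words by (rule UNION_singleton_eq_range)
  also have "\<dots> = cyclic_class ` closed_geodesics G \<iota>"
    unfolding image_image by (intro image_cong refl cls) (simp add: closed_geodesics_def)
  finally show ?thesis .
qed

lemma prime_len_pos: "\<gamma> \<in> primes G \<iota> \<Longrightarrow> prime_len \<gamma> > 0"
  by (auto simp: primes_eq closed_geodesics_def prime_len_cyclic_class min_period_pos)

end

text \<open>A prime of length n is a set of words of length n over the finite set of arcs, and there
  are finitely many such sets.\<close>

lemma (in fin_digraph) finite_primes_of_len: "finite {\<gamma> \<in> primes G \<iota>. prime_len \<gamma> = n}"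
proof (rule finite_subset)
  show "{\<gamma> \<in> primes G \<iota>. prime_len \<gamma> = n} \<subseteq> Pow {p. set p \<subseteq> arcs G \<and> length p = n}"
  proof
    fix \<gamma> assume "\<gamma> \<in> {\<gamma> \<in> primes G \<iota>. prime_len \<gamma> = n}"
    then obtain f where f: "f \<in> closed_geodesics G \<iota>" "\<gamma> = cyclic_class f" "prime_len (cyclic_class f) = n"
      unfolding primes_eq by blast
    then have "has_period f" "\<forall>i. f i \<in> arcs G"
      by (auto simp: closed_geodesics_def reduced_seq_def walk_seq_def)
    moreover from this f(3) have "min_period f = n" by (simp add: prime_len_cyclic_class)
    moreover note f(2)
    ultimately show "\<gamma> \<in> Pow {p. set p \<subseteq> arcs G \<and> length p = n}"
      by (auto simp: cyclic_class_def min_period_shift period_word_def shift_def)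
  qed
qed (simp add: finite_lists_length_eq)

lemma (in fin_digraph) ihara_zeta_eq:
  "ihara_zeta G \<iota> = multiset_gf (primes G \<iota>) prime_len (\<lambda>_. 1)"
  unfolding ihara_zeta_def
  using tendsto_multiset_gf[of "primes G \<iota>" prime_len "\<lambda>_. 1 :: rat"]
  by (intro tendsto_Lim) (simp_all add: prime_len_pos finite_primes_of_len)

section \<open>Lifting along a double cover\<close>

context double_cover
begin

text \<open>The nontrivial deck transformation on arcs. Fibres have two elements, so the choice is
  forced on \<open>arcs Y\<close>; elsewhere the value is arbitrary.\<close>

definition deck :: "'f \<Rightarrow> 'f" where
  "deck e = (SOME e'. e' \<in> arcs Y \<and> \<pi>\<^sub>E e' = \<pi>\<^sub>E e \<and> e' \<noteq> e)"

lemma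
  assumes "e \<in> arcs Y"
  shows deck_in_arcs: "deck e \<in> arcs Y"
    and proj_deck: "\<pi>\<^sub>E (deck e) = \<pi>\<^sub>E e"
    and deck_neq: "deck e \<noteq> e"
    and arc_fibre: "{e' \<in> arcs Y. \<pi>\<^sub>E e' = \<pi>\<^sub>E e} = {e, deck e}"
proof -
  let ?F = "{e' \<in> arcs Y. \<pi>\<^sub>E e' = \<pi>\<^sub>E e}"
  obtain a b where ab: "?F = {a, b}" "a \<noteq> b"
    using edge_fibre[OF edge_map[OF assms]] unfolding card_2_iff by blast
  have e: "e \<in> ?F" using assms by simp
  have "\<exists>e'. e' \<in> ?F \<and> e' \<noteq> e" unfolding ab(1) using ab(2) by blast
  then have "\<exists>e'. e' \<in> arcs Y \<and> \<pi>\<^sub>E e' = \<pi>\<^sub>E e \<and> e' \<noteq> e" by blast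
  then have d: "deck e \<in> arcs Y \<and> \<pi>\<^sub>E (deck e) = \<pi>\<^sub>E e \<and> deck e \<noteq> e"
    unfolding deck_def by (rule someI_ex)
  then show "deck e \<in> arcs Y" "\<pi>\<^sub>E (deck e) = \<pi>\<^sub>E e" "deck e \<noteq> e" by auto
  from d have "deck e \<in> ?F" by simp
  with e d show "?F = {e, deck e}" unfolding ab(1) by auto
qed

lemma arc_fibre_cases:
  assumes "e \<in> arcs Y" "e' \<in> arcs Y" "\<pi>\<^sub>E e' = \<pi>\<^sub>E e"
  shows "e' = e \<or> e' = deck e"
  using arc_fibre[OF assms(1)] assms(2,3) by blast

lemma deck_deck: "e \<in> arcs Y \<Longrightarrow> deck (deck e) = e"
  using arc_fibre_cases[of "deck e" e] deck_in_arcs[of e] proj_deck[of e] deck_neq[of e] by metis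

text \<open>The inverse of \<open>deck e\<close> lies in the fibre of the inverse of e and differs
  from it, since \<open>\<iota>\<^sub>Y\<close> is injective on arcs.\<close>

lemma deck_inv:
  assumes "e \<in> arcs Y"
  shows "deck (\<iota>\<^sub>Y e) = \<iota>\<^sub>Y (deck e)"
proof -
  note d = deck_in_arcs[OF assms] proj_deck[OF assms] deck_neq[OF assms]
  have "\<iota>\<^sub>Y (deck e) \<noteq> \<iota>\<^sub>Y e" using assms d Y.inv_inv by metis
  moreover have "\<pi>\<^sub>E (\<iota>\<^sub>Y (deck e)) = \<pi>\<^sub>E (\<iota>\<^sub>Y e)" using assms d inv_map by simp
  ultimately show ?thesis
    using arc_fibre_cases[of "\<iota>\<^sub>Y e" "\<iota>\<^sub>Y (deck e)"] assms d Y.inv_in_arcs by metis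
qed

lemma arc_eqI:
  assumes "e \<in> arcs Y" "e' \<in> arcs Y" "tail Y e = tail Y e'" "\<pi>\<^sub>E e = \<pi>\<^sub>E e'"
  shows "e = e'"
proof -
  have "inj_on \<pi>\<^sub>E (out_arcs Y (tail Y e))"
    using star_bij assms(1) bij_betw_imp_inj_on by (metis Y.tail_in_verts)
  then show ?thesis using assms by (auto simp: inj_on_def)
qed

text \<open>The deck map on arcs is compatible with a map on vertices: \<open>deck e\<close> cannot
  start where e does, by injectivity on stars, so it starts at the other vertex of the fibre, which
  depends only on the origin of e.\<close>

lemma tail_deck_eq:
  assumes "e \<in> arcs Y" "e' \<in> arcs Y" "tail Y e = tail Y e'"
  shows "tail Y (deck e) = tail Y (deck e')"
proof -
  let ?F = "{v \<in> verts Y. \<pi>\<^sub>V v = \<pi>\<^sub>V (tail Y e)}"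
  have other: "tail Y (deck a) \<in> ?F - {tail Y e}" if "a \<in> arcs Y" "tail Y a = tail Y e" for a
  proof -
    note d = deck_in_arcs[OF that(1)] proj_deck[OF that(1)] deck_neq[OF that(1)]
    have "\<pi>\<^sub>V (tail Y (deck a)) = \<pi>\<^sub>V (tail Y a)"
      using d that(1) by (metis tail_map)
    moreover have "tail Y (deck a) \<noteq> tail Y a"
      using arc_eqI[of "deck a" a] d that(1) by blast
    ultimately show ?thesis using d that by simp
  qed
  have "card ?F = 2"
    using assms(1) vertex_surj by (intro vertex_fibre) auto
  moreover have "tail Y e \<in> ?F" using assms(1) by simp
  ultimately have "card (?F - {tail Y e}) = 1" by (simp add: card_Diff_singleton)
  then obtain v where "?F - {tail Y e} = {v}" by (meson card_1_singletonE)
  then show ?thesis using other[of e] other[of e'] assms by simp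
qed

text \<open>The head of an arc is the tail of its inverse, and the deck map commutes with
  inversion.\<close>

lemma head_deck_eq_tail_deck:
  assumes "e \<in> arcs Y" "e' \<in> arcs Y" "head Y e = tail Y e'"
  shows "head Y (deck e) = tail Y (deck e')"
proof -
  have "head Y (deck e) = tail Y (deck (\<iota>\<^sub>Y e))"
    using assms(1) deck_in_arcs[OF assms(1)] by (simp add: deck_inv Y.tail_inv)
  also have "\<dots> = tail Y (deck e')"
    using assms by (intro tail_deck_eq) (simp_all add: Y.inv_in_arcs Y.tail_inv)
  finally show ?thesis .
qed

lemma walk_seq_deck: "walk_seq Y g \<Longrightarrow> walk_seq Y (deck \<circ> g)"
  by (auto simp: walk_seq_def deck_in_arcs intro!: head_deck_eq_tail_deck)

lemma proj_comp_deck: "walk_seq Y g \<Longrightarrow> \<pi>\<^sub>E \<circ> (deck \<circ> g) = \<pi>\<^sub>E \<circ> g"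
  by (auto simp: walk_seq_def proj_deck fun_eq_iff)

lemma deck_comp_deck: "walk_seq Y g \<Longrightarrow> deck \<circ> (deck \<circ> g) = g"
  by (auto simp: walk_seq_def deck_deck fun_eq_iff)

lemma walk_seq_proj: "walk_seq Y g \<Longrightarrow> walk_seq X (\<pi>\<^sub>E \<circ> g)"
  by (auto simp: walk_seq_def edge_map tail_map head_map)

lemma reduced_seq_proj_iff:
  assumes "walk_seq Y g"
  shows "reduced_seq X \<iota>\<^sub>X (\<pi>\<^sub>E \<circ> g) \<longleftrightarrow> reduced_seq Y \<iota>\<^sub>Y g"
proof -
  have "\<pi>\<^sub>E (g (Suc i)) = \<iota>\<^sub>X (\<pi>\<^sub>E (g i)) \<longleftrightarrow> g (Suc i) = \<iota>\<^sub>Y (g i)" for i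
  proof
    have g: "g i \<in> arcs Y" "g (Suc i) \<in> arcs Y" "head Y (g i) = tail Y (g (Suc i))"
      using assms by (auto simp: walk_seq_def)
    show "\<pi>\<^sub>E (g (Suc i)) = \<iota>\<^sub>X (\<pi>\<^sub>E (g i))" if "g (Suc i) = \<iota>\<^sub>Y (g i)"
      using that g by (simp add: inv_map)
    \<comment> \<open>Backtracking in X lifts: both arcs start at the head of \<open>g i\<close> and
      have the same image.\<close>
    show "g (Suc i) = \<iota>\<^sub>Y (g i)" if "\<pi>\<^sub>E (g (Suc i)) = \<iota>\<^sub>X (\<pi>\<^sub>E (g i))"
      using that g by (intro arc_eqI) (simp_all add: inv_map Y.inv_in_arcs Y.tail_inv)
  qed
  then show ?thesis using assms walk_seq_proj by (simp add: reduced_seq_def)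
qed

text \<open>Unique path lifting: injectivity on stars determines each arc from the preceding
  one.\<close>

lemma lift_unique:
  assumes "walk_seq Y g" "walk_seq Y g'" "\<pi>\<^sub>E \<circ> g' = \<pi>\<^sub>E \<circ> g" "g' 0 = g 0"
  shows "g' = g"
proof
  fix i show "g' i = g i"
  proof (induction i)
    case (Suc i)
    show ?case
    proof (rule arc_eqI)
      show "tail Y (g' (Suc i)) = tail Y (g (Suc i))"
        using assms(1,2) Suc unfolding walk_seq_def by metis
      show "\<pi>\<^sub>E (g' (Suc i)) = \<pi>\<^sub>E (g (Suc i))" using assms(3) by (metis comp_apply)
    qed (use assms in \<open>auto simp: walk_seq_def\<close>)
  qed (fact assms(4))
qed

lemma lift_cases:
  assumes "walk_seq Y g" "walk_seq Y g'" "\<pi>\<^sub>E \<circ> g' = \<pi>\<^sub>E \<circ> g"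
  shows "g' = g \<or> g' = deck \<circ> g"
proof -
  have "\<pi>\<^sub>E (g' 0) = \<pi>\<^sub>E (g 0)" using assms(3) by (metis comp_apply)
  then have "g' 0 = g 0 \<or> g' 0 = deck (g 0)"
    using assms by (intro arc_fibre_cases) (auto simp: walk_seq_def)
  then show ?thesis
    using lift_unique[OF assms] lift_unique[OF walk_seq_deck[OF assms(1)] assms(2)]
      proj_comp_deck[OF assms(1)] assms(3) by auto
qed

lemma lift_exists:
  assumes "walk_seq X f"
  obtains g where "walk_seq Y g" "\<pi>\<^sub>E \<circ> g = f"
proof -
  have "\<exists>g. \<forall>n. (g n \<in> arcs Y \<and> \<pi>\<^sub>E (g n) = f n) \<and> head Y (g n) = tail Y (g (Suc n))"
  proof (rule dependent_nat_choice)
    have "f 0 \<in> arcs X" using assms by (simp add: walk_seq_def)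
    then have "card {e \<in> arcs Y. \<pi>\<^sub>E e = f 0} = 2" by (rule edge_fibre)
    then have "{e \<in> arcs Y. \<pi>\<^sub>E e = f 0} \<noteq> {}" by force
    then show "\<exists>e. e \<in> arcs Y \<and> \<pi>\<^sub>E e = f 0" by blast
  next
    fix e n assume e: "e \<in> arcs Y \<and> \<pi>\<^sub>E e = f n"
    then have "\<pi>\<^sub>V (head Y e) = tail X (f (Suc n))" "f (Suc n) \<in> arcs X"
      using assms by (auto simp: walk_seq_def simp flip: head_map)
    \<comment> \<open>Surjectivity of the star map at the current endpoint supplies the next arc of
      the lift.\<close>
    then have "f (Suc n) \<in> out_arcs X (\<pi>\<^sub>V (head Y e))" by simp
    then have "f (Suc n) \<in> \<pi>\<^sub>E ` out_arcs Y (head Y e)"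
      using star_bij[of "head Y e"] e by (simp add: bij_betw_def)
    then show "\<exists>e'. (e' \<in> arcs Y \<and> \<pi>\<^sub>E e' = f (Suc n)) \<and> head Y e = tail Y e'"
      by auto
  qed
  then show ?thesis using that by (auto simp: walk_seq_def fun_eq_iff)
qed

section \<open>Shifts and periods of lifts\<close>

lemma walk_seq_shift: "walk_seq G g \<Longrightarrow> walk_seq G (shift n g)"
  by (simp add: walk_seq_def shift_def)

lemma shift_lift_cases:
  assumes "walk_seq Y g" "periodic l (\<pi>\<^sub>E \<circ> g)"
  shows "shift l g = g \<or> shift l g = deck \<circ> g"
  using assms by (intro lift_cases walk_seq_shift) (simp_all add: comp_shift periodic_iff_shift)

text \<open>One turn around the projection acts on the lift as the identity or as the deck
  involution, so two turns act trivially.\<close>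

lemma periodic_double:
  assumes "walk_seq Y g" "periodic l (\<pi>\<^sub>E \<circ> g)"
  shows "periodic (2 * l) g"
proof -
  have "shift (l + l) g = g"
    using shift_lift_cases[OF assms] deck_comp_deck[OF assms(1)]
    by (metis comp_shift shift_shift)
  then show ?thesis by (simp add: periodic_iff_shift mult_2)
qed

lemma has_period_lift:
  assumes "walk_seq Y g" "has_period (\<pi>\<^sub>E \<circ> g)"
  shows "has_period g"
proof -
  obtain l where "l > 0" "periodic l (\<pi>\<^sub>E \<circ> g)" using assms(2) by (auto simp: has_period_def)
  with periodic_double[OF assms(1)] show ?thesis
    unfolding has_period_def by (metis mult_pos_pos zero_less_numeral)
qed

lemma periodic_deck_iff:
  assumes "walk_seq Y g"
  shows "periodic k (deck \<circ> g) \<longleftrightarrow> periodic k g"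
  unfolding periodic_iff_shift comp_shift[symmetric]
  by (metis assms deck_comp_deck comp_shift)

lemma deck_comp_neq: "walk_seq Y g \<Longrightarrow> deck \<circ> g \<noteq> g"
  by (metis comp_apply deck_neq walk_seq_def)

lemma closed_geodesics_proj_iff:
  assumes "walk_seq Y g"
  shows "\<pi>\<^sub>E \<circ> g \<in> closed_geodesics X \<iota>\<^sub>X \<longleftrightarrow> g \<in> closed_geodesics Y \<iota>\<^sub>Y"
  using has_period_comp[of g \<pi>\<^sub>E] has_period_lift[OF assms] reduced_seq_proj_iff[OF assms]
  by (auto simp: closed_geodesics_def)

section \<open>Splitting of primes\<close>

text \<open>A closed lift q of a rotated representative extends cyclically to a lift of the shifted
  sequence, which leaves two candidates; having length l, it also forces l to be a period of g. No
  reducedness of q is assumed, since \<open>inert_prime\<close> speaks of all closed lifts.\<close>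

lemma lifted_word:
  assumes g: "walk_seq Y g" "has_period (\<pi>\<^sub>E \<circ> g)"
    and q: "Y.closed_w q" "map \<pi>\<^sub>E q = period_word (shift n (\<pi>\<^sub>E \<circ> g))"
  defines "l \<equiv> min_period (\<pi>\<^sub>E \<circ> g)"
  shows "periodic l g \<and>
    (q = map (shift n g) [0..<l] \<or> q = map (shift n (deck \<circ> g)) [0..<l])"
proof -
  have q': "q \<noteq> []" "walk_seq Y (cyclic_seq q)" using q(1) by (auto simp: Y.closed_w_iff)
  have len: "length q = l"
    using arg_cong[OF q(2), of length] g(2) by (simp add: l_def min_period_shift)
  have "\<pi>\<^sub>E \<circ> cyclic_seq q = cyclic_seq (map \<pi>\<^sub>E q)" using q'(1) by (simp add: cyclic_seq_map)
  also have "\<dots> = \<pi>\<^sub>E \<circ> shift n g"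
    by (simp add: q(2) cyclic_seq_period_word has_period_shift g(2) comp_shift)
  finally have "cyclic_seq q = shift n g \<or> cyclic_seq q = deck \<circ> shift n g"
    using q'(2) g(1) by (intro lift_cases walk_seq_shift)
  then have c: "cyclic_seq q = shift n g \<or> cyclic_seq q = shift n (deck \<circ> g)"
    by (simp add: comp_shift)
  have "periodic l (cyclic_seq q)" by (simp add: periodic_def cyclic_seq_def len)
  with c have "periodic l (shift n g) \<or> periodic l (shift n (deck \<circ> g))" by auto
  then have "periodic l g"
    using has_period_lift[OF g] has_period_comp[of g deck]
    by (simp add: periodic_shift_iff periodic_deck_iff[OF g(1)])
  moreover have "q = map (cyclic_seq q) [0..<l]" by (simp add: map_cyclic_seq flip: len)
  ultimately show ?thesis using c by auto
qed

lemma closed_reduced_lift: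
  assumes "reduced_seq Y \<iota>\<^sub>Y g" "periodic l g" "l > 0"
  shows "closed_reduced Y \<iota>\<^sub>Y (map (shift n g) [0..<l])"
proof -
  have "periodic l (shift n g)"
    using assms periodic_shift_iff[of g l n] by (auto simp: has_period_def)
  then show ?thesis
    using assms(1,3)
    by (simp add: Y.closed_reduced_iff cyclic_seq_map_upt) (simp add: reduced_seq_def walk_seq_def shift_def)
qed

text \<open>By \<open>lifted_word\<close> only the lifts along g and along its deck image can close
  up after one turn, and both do so exactly when the least period of the projection is a period of
  g.\<close>

lemma chi_prime_cyclic_class:
  assumes g: "g \<in> closed_geodesics Y \<iota>\<^sub>Y"
  shows "chi_prime Y \<iota>\<^sub>Y \<pi>\<^sub>E (cyclic_class (\<pi>\<^sub>E \<circ> g)) =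
    (if periodic (min_period (\<pi>\<^sub>E \<circ> g)) g then 1 else - 1)"
proof -
  let ?f = "\<pi>\<^sub>E \<circ> g" and ?l = "min_period (\<pi>\<^sub>E \<circ> g)"
  have w: "walk_seq Y g" "reduced_seq Y \<iota>\<^sub>Y g"
    using g by (auto simp: closed_geodesics_def reduced_seq_def)
  have f: "has_period ?f" using g by (auto simp: closed_geodesics_def has_period_comp)
  have l: "?l > 0" using f by (rule min_period_pos)
  let ?S = "\<lambda>p. {q. closed_reduced Y \<iota>\<^sub>Y q \<and> map \<pi>\<^sub>E q = p}"
  show ?thesis
  proof (cases "periodic ?l g")
    case True
    have "card (?S p) = 2" if p_in: "p \<in> cyclic_class ?f" for p
    proof -
      obtain n where p: "p = period_word (shift n ?f)" using p_in by (auto simp: cyclic_class_def)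
      let ?q = "map (shift n g) [0..<?l]" and ?q' = "map (shift n (deck \<circ> g)) [0..<?l]"
      have rd: "reduced_seq Y \<iota>\<^sub>Y (deck \<circ> g)"
        using w walk_seq_deck proj_comp_deck reduced_seq_proj_iff by metis
      have p': "p = map (shift n ?f) [0..<?l]"
        by (simp add: p period_word_def min_period_shift f)
      have "map \<pi>\<^sub>E ?q = p" by (simp add: p' comp_shift)
      moreover have "map \<pi>\<^sub>E ?q' = p"
        by (simp only: p' map_map comp_shift proj_comp_deck[OF w(1)])
      moreover have "closed_reduced Y \<iota>\<^sub>Y ?q" "closed_reduced Y \<iota>\<^sub>Y ?q'"
        using w rd True l periodic_deck_iff[OF w(1)] by (auto intro!: closed_reduced_lift)
      moreover have "q = ?q \<or> q = ?q'" if "q \<in> ?S p" for q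
        using that lifted_word[OF w(1) f, of q n] p by (auto simp: closed_reduced_def)
      ultimately have "?S p = {?q, ?q'}" by blast
      \<comment> \<open>The two lifts differ in their first arc because the deck map has no fixed
        arc.\<close>
      moreover have "g n \<noteq> deck (g n)" using w(1) deck_neq[of "g n"] by (auto simp: walk_seq_def)
      then have "?q ! 0 \<noteq> ?q' ! 0" using l by (simp add: shift_def)
      then have "?q \<noteq> ?q'" by metis
      ultimately show ?thesis by simp
    qed
    then have "split_prime Y \<iota>\<^sub>Y \<pi>\<^sub>E (cyclic_class ?f)" by (simp add: split_prime_def)
    with True show ?thesis by (simp add: chi_prime_def)
  next
    case False
    then have none: "\<not> (Y.closed_w q \<and> map \<pi>\<^sub>E q = p)" if "p \<in> cyclic_class ?f" for p q
      using that lifted_word[OF w(1) f, of q] by (auto simp: cyclic_class_def)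
    then have "inert_prime Y \<pi>\<^sub>E (cyclic_class ?f)" by (auto simp: inert_prime_def)
    \<comment> \<open>\<open>chi_prime\<close> tests for splitting first, so splitting has to be
      refuted too; a single representative without closed lifts suffices.\<close>
    moreover have "?S (period_word ?f) = {}"
      using none[OF period_word_in_cyclic_class] by (auto simp: closed_reduced_def)
    then have "card (?S (period_word ?f)) = 0" by (simp only: card.empty)
    then have "card (?S (period_word ?f)) \<noteq> 2" by linarith
    then have "\<not> split_prime Y \<iota>\<^sub>Y \<pi>\<^sub>E (cyclic_class ?f)"
      unfolding split_prime_def using period_word_in_cyclic_class[of ?f] by blast
    ultimately show ?thesis using False by (simp add: chi_prime_def)
  qed
qed

text \<open>Projection is applied to sequences, not to words: over an inert prime the projected word
  runs twice through the prime, whereas the projected sequence determines the prime itself.\<close>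

definition primes_over :: "'e list set \<Rightarrow> 'f list set set" where
  "primes_over \<gamma> = cyclic_class ` {g \<in> closed_geodesics Y \<iota>\<^sub>Y. cyclic_class (\<pi>\<^sub>E \<circ> g) = \<gamma>}"

lemma closed_geodesic_proj:
  "g \<in> closed_geodesics Y \<iota>\<^sub>Y \<Longrightarrow> \<pi>\<^sub>E \<circ> g \<in> closed_geodesics X \<iota>\<^sub>X"
  using closed_geodesics_proj_iff by (auto simp: closed_geodesics_def reduced_seq_def)

lemma primes_eq_UN_primes_over: "primes Y \<iota>\<^sub>Y = (\<Union>\<gamma>\<in>primes X \<iota>\<^sub>X. primes_over \<gamma>)"
  unfolding Y.primes_eq X.primes_eq primes_over_def using closed_geodesic_proj by blast

text \<open>Projection commutes with shifts, so the class of the projection depends only on the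
  class of g.\<close>

lemma primes_over_disjoint:
  assumes "\<gamma> \<noteq> \<gamma>'"
  shows "primes_over \<gamma> \<inter> primes_over \<gamma>' = {}"
proof -
  have "cyclic_class (\<pi>\<^sub>E \<circ> g) = cyclic_class (\<pi>\<^sub>E \<circ> g')"
    if "g \<in> closed_geodesics Y \<iota>\<^sub>Y" "g' \<in> closed_geodesics Y \<iota>\<^sub>Y" "cyclic_class g = cyclic_class g'"
    for g g'
    using that has_period_comp[of _ \<pi>\<^sub>E]
    by (auto simp: closed_geodesics_def cyclic_class_eq_iff comp_shift)
  with assms show ?thesis by (auto simp: primes_over_def)
qed

text \<open>A suitable shift of any g' over the same prime has the same projection as g, and then it
  is one of the only two lifts.\<close>

lemma primes_over_cyclic_class:
  assumes g: "g \<in> closed_geodesics Y \<iota>\<^sub>Y"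
  shows "primes_over (cyclic_class (\<pi>\<^sub>E \<circ> g)) = {cyclic_class g, cyclic_class (deck \<circ> g)}"
proof
  have w: "walk_seq Y g" using g by (auto simp: closed_geodesics_def reduced_seq_def)
  then have "deck \<circ> g \<in> closed_geodesics Y \<iota>\<^sub>Y"
    using g closed_geodesics_proj_iff walk_seq_deck proj_comp_deck by metis
  with g proj_comp_deck[OF w]
  show "{cyclic_class g, cyclic_class (deck \<circ> g)} \<subseteq> primes_over (cyclic_class (\<pi>\<^sub>E \<circ> g))"
    by (auto simp: primes_over_def)
  show "primes_over (cyclic_class (\<pi>\<^sub>E \<circ> g)) \<subseteq> {cyclic_class g, cyclic_class (deck \<circ> g)}"
  proof
    fix \<gamma> assume "\<gamma> \<in> primes_over (cyclic_class (\<pi>\<^sub>E \<circ> g))"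
    then obtain g' where g': "g' \<in> closed_geodesics Y \<iota>\<^sub>Y" "\<gamma> = cyclic_class g'"
        "cyclic_class (\<pi>\<^sub>E \<circ> g') = cyclic_class (\<pi>\<^sub>E \<circ> g)"
      by (auto simp: primes_over_def)
    have per: "has_period g'" "has_period g" using g g'(1) by (auto simp: closed_geodesics_def)
    with g'(3) obtain n where "\<pi>\<^sub>E \<circ> g = shift n (\<pi>\<^sub>E \<circ> g')"
      using has_period_comp[of _ \<pi>\<^sub>E] by (auto simp: cyclic_class_eq_iff)
    then have "\<pi>\<^sub>E \<circ> shift n g' = \<pi>\<^sub>E \<circ> g" by (simp add: comp_shift)
    moreover have "walk_seq Y g'" using g'(1) by (auto simp: closed_geodesics_def reduced_seq_def)
    ultimately have "shift n g' = g \<or> shift n g' = deck \<circ> g"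
      using w by (intro lift_cases walk_seq_shift)
    then show "\<gamma> \<in> {cyclic_class g, cyclic_class (deck \<circ> g)}"
      using cyclic_class_shift[OF per(1), of n] g'(2) by (metis insert_iff)
  qed
qed

text \<open>If the two classes agreed, the deck image of g would be a shift of g by some n.
  Projecting, n is a multiple of the common least period, so the shift is trivial, against the
  freeness of the deck map.\<close>

lemma primes_over_split:
  assumes g: "g \<in> closed_geodesics Y \<iota>\<^sub>Y" and per: "periodic (min_period (\<pi>\<^sub>E \<circ> g)) g"
  shows "cyclic_class g \<noteq> cyclic_class (deck \<circ> g)"
    and "prime_len (cyclic_class g) = min_period (\<pi>\<^sub>E \<circ> g)"
    and "prime_len (cyclic_class (deck \<circ> g)) = min_period (\<pi>\<^sub>E \<circ> g)"
proof -
  let ?f = "\<pi>\<^sub>E \<circ> g" and ?l = "min_period (\<pi>\<^sub>E \<circ> g)"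
  have w: "walk_seq Y g" and hp: "has_period g"
    using g by (auto simp: closed_geodesics_def reduced_seq_def)
  have hf: "has_period ?f" and hd: "has_period (deck \<circ> g)" using hp by (auto intro: has_period_comp)
  have down: "periodic k ?f" if "periodic k g" for k using that by (simp add: periodic_def)
  have "?l dvd min_period g"
    using down[OF periodic_min_period[OF hp]] by (simp add: periodic_iff_dvd[OF hf])
  moreover have "min_period g dvd ?l" using per by (simp add: periodic_iff_dvd[OF hp])
  ultimately have l: "min_period g = ?l" by (rule dvd_antisym[symmetric])
  then show "prime_len (cyclic_class g) = ?l" by (simp add: prime_len_cyclic_class hp)
  have "min_period (deck \<circ> g) = min_period g"
    by (simp add: min_period_def periodic_deck_iff[OF w])
  with l show "prime_len (cyclic_class (deck \<circ> g)) = ?l" by (simp add: prime_len_cyclic_class hd)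
  show "cyclic_class g \<noteq> cyclic_class (deck \<circ> g)"
  proof
    assume "cyclic_class g = cyclic_class (deck \<circ> g)"
    then obtain n where n: "deck \<circ> g = shift n g"
      using cyclic_class_eq_iff[OF hp hd] by blast
    then have "shift n ?f = ?f" using proj_comp_deck[OF w] by (metis comp_shift)
    then have "?l dvd n" by (simp add: periodic_iff_dvd[OF hf] flip: periodic_iff_shift)
    then have "shift n g = g" by (simp add: periodic_iff_dvd[OF hp] l flip: periodic_iff_shift)
    with n deck_comp_neq[OF w] show False by simp
  qed
qed

text \<open>Shifting by the least period of the projection realises the deck map, so the two lifts
  share a class. The least period of g is that of the projection times k, where k divides 2 and is
  not 1.\<close>

lemma primes_over_inert:
  assumes g: "g \<in> closed_geodesics Y \<iota>\<^sub>Y" and per: "\<not> periodic (min_period (\<pi>\<^sub>E \<circ> g)) g"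
  shows "cyclic_class (deck \<circ> g) = cyclic_class g"
    and "prime_len (cyclic_class g) = 2 * min_period (\<pi>\<^sub>E \<circ> g)"
proof -
  let ?f = "\<pi>\<^sub>E \<circ> g" and ?l = "min_period (\<pi>\<^sub>E \<circ> g)"
  have w: "walk_seq Y g" and hp: "has_period g"
    using g by (auto simp: closed_geodesics_def reduced_seq_def)
  have hf: "has_period ?f" using hp by (rule has_period_comp)
  have pf: "periodic ?l ?f" using hf by (rule periodic_min_period)
  have "shift ?l g = deck \<circ> g"
    using shift_lift_cases[OF w pf] per by (simp add: periodic_iff_shift)
  then show "cyclic_class (deck \<circ> g) = cyclic_class g" using cyclic_class_shift[OF hp] by metis
  have "periodic (min_period g) ?f" using periodic_min_period[OF hp] by (simp add: periodic_def)
  then obtain k where k: "min_period g = ?l * k" using periodic_iff_dvd[OF hf] by auto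
  have "min_period g dvd 2 * ?l"
    using periodic_double[OF w pf] by (simp add: periodic_iff_dvd[OF hp])
  then have "?l * k dvd ?l * 2" by (simp add: k mult.commute)
  then have "k dvd 2" using min_period_pos[OF hf] by simp
  moreover have "k \<noteq> 1" using k per periodic_min_period[OF hp] by auto
  ultimately have "k = 2" using prime_nat_iff two_is_prime_nat by blast
  with k show "prime_len (cyclic_class g) = 2 * ?l" by (simp add: prime_len_cyclic_class hp)
qed

text \<open>The length inequality ensures that primes of Y of length at most n lie over the finitely
  many primes of X of length at most n.\<close>

lemma
  assumes \<gamma>: "\<gamma> \<in> primes X \<iota>\<^sub>X"
  shows finite_primes_over: "finite (primes_over \<gamma>)"
    and prime_len_primes_over: "\<gamma>' \<in> primes_over \<gamma> \<Longrightarrow> prime_len \<gamma> \<le> prime_len \<gamma>'"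
    and prod_primes_over:
      "(\<Prod>\<gamma>'\<in>primes_over \<gamma>. inverse (1 - fps_X ^ prime_len \<gamma>')) =
        inverse (1 - fps_X ^ prime_len \<gamma>) *
        inverse (1 - fps_const (of_int (chi_prime Y \<iota>\<^sub>Y \<pi>\<^sub>E \<gamma>)) * fps_X ^ prime_len \<gamma> :: rat fps)"
proof -
  obtain f where f: "f \<in> closed_geodesics X \<iota>\<^sub>X" "\<gamma> = cyclic_class f"
    using \<gamma> by (auto simp: X.primes_eq)
  then obtain g where g: "walk_seq Y g" "\<pi>\<^sub>E \<circ> g = f"
    using lift_exists[of f] by (auto simp: closed_geodesics_def reduced_seq_def)
  then have cg: "g \<in> closed_geodesics Y \<iota>\<^sub>Y" using closed_geodesics_proj_iff f(1) by metis
  have over: "primes_over \<gamma> = {cyclic_class g, cyclic_class (deck \<circ> g)}"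
    using primes_over_cyclic_class[OF cg] by (simp add: f g)
  then show "finite (primes_over \<gamma>)" by simp
  have len: "prime_len \<gamma> = min_period f"
    using f by (simp add: closed_geodesics_def prime_len_cyclic_class)
  have chi: "chi_prime Y \<iota>\<^sub>Y \<pi>\<^sub>E \<gamma> = (if periodic (min_period f) g then 1 else - 1)"
    using chi_prime_cyclic_class[OF cg] by (simp add: f g)
  show "prime_len \<gamma> \<le> prime_len \<gamma>'" if "\<gamma>' \<in> primes_over \<gamma>"
    using that primes_over_split[OF cg] primes_over_inert[OF cg]
    by (cases "periodic (min_period f) g") (auto simp: over len g(2))
  show "(\<Prod>\<gamma>'\<in>primes_over \<gamma>. inverse (1 - fps_X ^ prime_len \<gamma>')) =
        inverse (1 - fps_X ^ prime_len \<gamma>) *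
        inverse (1 - fps_const (of_int (chi_prime Y \<iota>\<^sub>Y \<pi>\<^sub>E \<gamma>)) * fps_X ^ prime_len \<gamma> :: rat fps)"
  proof (cases "periodic (min_period f) g")
    case True
    with primes_over_split[OF cg] show ?thesis by (simp add: over len chi g(2))
  next
    case False
    \<comment> \<open>The factor of the single prime above splits as (1 - u^l)(1 + u^l); the second
      factor is the one with character value -1.\<close>
    have "1 - fps_X ^ (2 * min_period f) =
        (1 - fps_X ^ min_period f) * (1 - fps_const (- 1) * fps_X ^ min_period f :: rat fps)"
      by (simp add: algebra_simps power_add[symmetric] mult_2_right flip: fps_const_neg)
    with False primes_over_inert[OF cg] show ?thesis
      by (simp add: over len chi g(2) fps_inverse_mult)
  qed
qed

section \<open>Comparison of the two zeta functions\<close>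

lemma ihara_zeta_cover:
  assumes "fin_digraph X" "fin_digraph Y"
  shows "ihara_zeta Y \<iota>\<^sub>Y = ihara_zeta X \<iota>\<^sub>X *
    multiset_gf (primes X \<iota>\<^sub>X) prime_len (\<lambda>\<gamma>. of_int (chi_prime Y \<iota>\<^sub>Y \<pi>\<^sub>E \<gamma>))"
proof (rule fps_ext)
  interpret finX: fin_digraph X by fact
  interpret finY: fin_digraph Y by fact
  fix n
  let ?c = "\<lambda>\<gamma>. of_int (chi_prime Y \<iota>\<^sub>Y \<pi>\<^sub>E \<gamma>) :: rat"
  \<comment> \<open>A contains the primes of X that can affect coefficient n. B consists of complete
    fibres over A, so it may contain primes longer than n: the product over B can then be grouped by
    fibres, and the extra primes do not change coefficient n.\<close>
  define A where "A = {\<gamma> \<in> primes X \<iota>\<^sub>X. prime_len \<gamma> \<le> n}"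
  define B where "B = (\<Union>\<gamma>\<in>A. primes_over \<gamma>)"
  have AX: "A \<subseteq> primes X \<iota>\<^sub>X" by (auto simp: A_def)
  then have BY: "B \<subseteq> primes Y \<iota>\<^sub>Y" by (auto simp: B_def primes_eq_UN_primes_over)
  have posA: "prime_len \<gamma> > 0" if "\<gamma> \<in> A" for \<gamma> using that AX X.prime_len_pos by blast
  have posB: "prime_len \<gamma> > 0" if "\<gamma> \<in> B" for \<gamma> using that BY Y.prime_len_pos by blast
  have "A = (\<Union>k\<le>n. {\<gamma> \<in> primes X \<iota>\<^sub>X. prime_len \<gamma> = k})" by (auto simp: A_def)
  then have finA: "finite A" by (simp add: finX.finite_primes_of_len)
  then have finB: "finite B" using AX finite_primes_over by (auto simp: B_def)
  have short: "{\<gamma> \<in> primes Y \<iota>\<^sub>Y. prime_len \<gamma> \<le> n} \<subseteq> B"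
    unfolding B_def A_def primes_eq_UN_primes_over
    using prime_len_primes_over order_trans by blast
  have "multiset_gf B prime_len (\<lambda>_. 1) = (\<Prod>\<gamma>'\<in>B. inverse (1 - fps_X ^ prime_len \<gamma>') :: rat fps)"
    using prod_inverse_eq_multiset_gf[OF finB posB, where c = "\<lambda>_. 1 :: rat"] by simp
  also have "\<dots> = (\<Prod>\<gamma>\<in>A. \<Prod>\<gamma>'\<in>primes_over \<gamma>. inverse (1 - fps_X ^ prime_len \<gamma>'))"
    unfolding B_def using finA AX finite_primes_over primes_over_disjoint
    by (intro prod.UNION_disjoint) auto
  also have "\<dots> = (\<Prod>\<gamma>\<in>A. inverse (1 - fps_X ^ prime_len \<gamma>) *
      inverse (1 - fps_const (?c \<gamma>) * fps_X ^ prime_len \<gamma>))"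
    using AX by (intro prod.cong) (auto simp: prod_primes_over)
  also have "\<dots> = multiset_gf A prime_len (\<lambda>_. 1) * multiset_gf A prime_len ?c"
    using prod_inverse_eq_multiset_gf[OF finA posA, where c = "\<lambda>_. 1 :: rat"]
      prod_inverse_eq_multiset_gf[OF finA posA, where c = ?c] by (simp add: prod.distrib)
  finally have fin: "multiset_gf B prime_len (\<lambda>_. 1) =
      multiset_gf A prime_len (\<lambda>_. 1) * multiset_gf A prime_len ?c" .
  have truncX: "multiset_gf (primes X \<iota>\<^sub>X) prime_len c $ k = multiset_gf A prime_len c $ k"
    if "k \<le> n" for k and c :: "_ \<Rightarrow> rat"
    using AX that by (intro multiset_gf_nth_truncate) (auto simp: A_def)
  have "ihara_zeta Y \<iota>\<^sub>Y $ n = multiset_gf B prime_len (\<lambda>_. 1) $ n"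
    unfolding finY.ihara_zeta_eq using BY short by (intro multiset_gf_nth_truncate) auto
  \<comment> \<open>Coefficient n of a product involves only coefficients up to n of its factors,
    where truncation to A is exact.\<close>
  also have "\<dots> = (ihara_zeta X \<iota>\<^sub>X * multiset_gf (primes X \<iota>\<^sub>X) prime_len ?c) $ n"
    unfolding fin finX.ihara_zeta_eq fps_mult_nth by (intro sum.cong) (auto simp: truncX)
  finally show "ihara_zeta Y \<iota>\<^sub>Y $ n =
      (ihara_zeta X \<iota>\<^sub>X * multiset_gf (primes X \<iota>\<^sub>X) prime_len ?c) $ n" .
qed

end

theorem mainTheorem4:
  fixes X :: "('v, 'e) pre_digraph" and \<iota>\<^sub>X :: "'e \<Rightarrow> 'e"
    and Y :: "('w, 'f) pre_digraph" and \<iota>\<^sub>Y :: "'f \<Rightarrow> 'f"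
    and \<pi>\<^sub>V :: "'w \<Rightarrow> 'v" and \<pi>\<^sub>E :: "'f \<Rightarrow> 'e"
  assumes "double_cover Y \<iota>\<^sub>Y X \<iota>\<^sub>X \<pi>\<^sub>V \<pi>\<^sub>E"
    and "fin_digraph X" and "fin_digraph Y"
    and "Digraph_Component.connected X"
  shows "ihara_zeta Y \<iota>\<^sub>Y / ihara_zeta X \<iota>\<^sub>X =
    Abs_fps (\<lambda>n. of_int
      (\<Sum>\<alpha> \<in> {\<alpha> \<in> effective_cycles X \<iota>\<^sub>X. cycle_len \<alpha> = n}. chi Y \<iota>\<^sub>Y \<pi>\<^sub>E \<alpha>))"
proof -
  interpret double_cover Y \<iota>\<^sub>Y X \<iota>\<^sub>X \<pi>\<^sub>V \<pi>\<^sub>E by fact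
  interpret fin_digraph X by fact
  let ?gf = "multiset_gf (primes X \<iota>\<^sub>X) prime_len (\<lambda>\<gamma>. of_int (chi_prime Y \<iota>\<^sub>Y \<pi>\<^sub>E \<gamma>)) :: rat fps"
  \<comment> \<open>Constant term 1 makes the series nonzero, so it can be cancelled in the
    quotient.\<close>
  have "ihara_zeta X \<iota>\<^sub>X $ 0 = 1"
    unfolding ihara_zeta_eq using X.prime_len_pos by (rule multiset_gf_nth_0)
  then have "ihara_zeta X \<iota>\<^sub>X \<noteq> 0" by auto
  then have "ihara_zeta Y \<iota>\<^sub>Y / ihara_zeta X \<iota>\<^sub>X = ?gf"
    using ihara_zeta_cover[OF assms(2,3)] by simp
  moreover have "(of_int (chi Y \<iota>\<^sub>Y \<pi>\<^sub>E \<alpha>) :: rat) =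
      (\<Prod>\<gamma>\<in>#\<alpha>. of_int (chi_prime Y \<iota>\<^sub>Y \<pi>\<^sub>E \<gamma>))" for \<alpha>
    unfolding chi_def by (induction \<alpha>) auto
  then have "?gf = Abs_fps (\<lambda>n. of_int
      (\<Sum>\<alpha> \<in> {\<alpha> \<in> effective_cycles X \<iota>\<^sub>X. cycle_len \<alpha> = n}. chi Y \<iota>\<^sub>Y \<pi>\<^sub>E \<alpha>))"
    by (simp add: multiset_gf_def multisets_of_weight_def effective_cycles_def cycle_len_def)
  ultimately show ?thesis by simp
qed

end
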